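(* For every unleveled context stack $\Delta$ and unleveled type $A$, the judgment $\Delta\vdash A$ is derivable in the unleveled Fitch-style calculus if and only if there exist a level $l$, a leveled context stack $\Delta'$ and a leveled type $A'$ such that $\Delta'\vdash^l A'$ is derivable in $\lambda^\Box$, $|\Delta'| = \Delta$ and $|A'| = A$.
   Context: Leveled calculus $\lambda^\Box$: levels are natural numbers; types of level $l$ are base types $\iota^l$, $A^l\to B^l$, and (for $l\ge1$) $\Box A^{l-1}$. A context of level $l$ is a list of variable declarations of level-$l$ types; a context stack of level $l$ is a sequence $\Gamma^{l+n-1};\dots;\Gamma^l$ ($n\ge0$) with levels decreasing by one from left to right. Rules: (Var) if $x:A\in\Gamma^l$ then $\Delta^{l+1};\Gamma^l\vdash^l x:A$; (Abs) from $\Delta^{l+1};\Gamma^l,x:A\vdash^l M:B$ infer $\Delta^{l+1};\Gamma^l\vdash^l\lambda x.M:A\to B$; (App) from $\Delta^l\vdash^l M:A\to B$ and $\Delta^l\vdash^l N:A$ infer $\Delta^l\vdash^l MN:B$; (Quo) from $\Delta^{l+1};\cdot\vdash^l M:A$ infer $\Delta^{l+1}\vdash^{l+1}\grave{}M:\Box A$; (Unq) from $\Delta^{l+1}\vdash^{l+1}M:\Box A$ infer $\Delta^{l+1};\Gamma^l\vdash^l{,}M:A$ for any context $\Gamma^l$. The unleveled Fitch-style calculus has types $\iota\mid A\to B\mid\Box A$, contexts and context stacks (sequences of contexts separated by semicolons) without levels, judgments $\Delta\vdash M:A$, and the same five rules with all level annotations erased. For each unleveled base type $\iota$ and level $l$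 there is a leveled base type $\iota^l$; the forgetful function $|\cdot|$ erases levels ($|\iota^l|=\iota$, homomorphically on types, contexts and stacks). $\Delta\vdash A$ means some term of type $A$ is derivable. *)

theory Defs
  imports Main
begin

text \<open>
  Variables are named, and the names declared in one context are pairwise distinct. A context
  \<open>\<Gamma>, x : A\<close> is represented by \<open>(x, A) # \<Gamma>\<close> and a context stack
  \<open>\<Delta>; \<Gamma>\<close> by \<open>\<Gamma> # \<Delta>\<close>, so the rightmost entry comes first.
  The empty stack is allowed. Base types are the elements of an arbitrary type \<open>'b\<close>.
\<close>

type_synonym vname = string

text \<open>
  Abstractions carry no type annotation, and terms carry no levels, so both calculi have the same
  raw terms.
\<close>

datatype trm =
    Var vname
  | Abs vname trm
  | App trm trm
  | Quo trm
  | Unq trm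


section \<open>The unleveled Fitch-style calculus\<close>

datatype 'b ty =
    Base 'b
  | Fun "'b ty" "'b ty"
  | Box "'b ty"

type_synonym 'b ctx = "(vname \<times> 'b ty) list"
type_synonym 'b stack = "'b ctx list"

definition is_ctx :: "'b ctx \<Rightarrow> bool" where
  "is_ctx \<Gamma> \<longleftrightarrow> distinct (map fst \<Gamma>)"

definition is_stack :: "'b stack \<Rightarrow> bool" where
  "is_stack \<Delta> \<longleftrightarrow> (\<forall>\<Gamma> \<in> set \<Delta>. is_ctx \<Gamma>)"

text \<open>
  Well-formedness is only required where a rule introduces a new context or stack; the other rules
  inherit it from their premises (see \<open>typing_wf\<close>). In particular the premise of the
  abstraction rule forces \<open>x\<close> to be fresh for \<open>\<Gamma>\<close>.
\<close>

inductive typing :: "'b stack \<Rightarrow> trm \<Rightarrow> 'b ty \<Rightarrow> bool" where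
  Var: "is_stack (\<Gamma> # \<Delta>) \<Longrightarrow> (x, A) \<in> set \<Gamma> \<Longrightarrow> typing (\<Gamma> # \<Delta>) (Var x) A"
| Abs: "typing (((x, A) # \<Gamma>) # \<Delta>) M B \<Longrightarrow> typing (\<Gamma> # \<Delta>) (Abs x M) (Fun A B)"
| App: "typing \<Delta> M (Fun A B) \<Longrightarrow> typing \<Delta> N A \<Longrightarrow> typing \<Delta> (App M N) B"
| Quo: "typing ([] # \<Delta>) M A \<Longrightarrow> typing \<Delta> (Quo M) (Box A)"
| Unq: "typing \<Delta> M (Box A) \<Longrightarrow> is_ctx \<Gamma> \<Longrightarrow> typing (\<Gamma> # \<Delta>) (Unq M) A"

definition derivable :: "'b stack \<Rightarrow> 'b ty \<Rightarrow> bool" where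
  "derivable \<Delta> A \<longleftrightarrow> (\<exists>M. typing \<Delta> M A)"

lemma typing_wf: "typing \<Delta> M A \<Longrightarrow> is_stack \<Delta>"
  by (induction rule: typing.induct) (auto simp: is_stack_def is_ctx_def)


section \<open>The leveled calculus\<close>

text \<open>
  \<open>LBase b l\<close> is the base type \<open>b\<close> at level \<open>l\<close>. The datatype also
  contains ill-leveled expressions; \<open>is_lty l\<close> singles out the types of level \<open>l\<close>.
\<close>

datatype 'b lty =
    LBase 'b nat
  | LFun "'b lty" "'b lty"
  | LBox "'b lty"

type_synonym 'b lctx = "(vname \<times> 'b lty) list"
type_synonym 'b lstack = "'b lctx list"

inductive is_lty :: "nat \<Rightarrow> 'b lty \<Rightarrow> bool" where
  "is_lty l (LBase b l)"
| "is_lty l A \<Longrightarrow> is_lty l B \<Longrightarrow> is_lty l (LFun A B)"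
| "is_lty l A \<Longrightarrow> is_lty (Suc l) (LBox A)"

definition is_lctx :: "nat \<Rightarrow> 'b lctx \<Rightarrow> bool" where
  "is_lctx l \<Gamma> \<longleftrightarrow> distinct (map fst \<Gamma>) \<and> (\<forall>(x, A) \<in> set \<Gamma>. is_lty l A)"

text \<open>The empty stack is a context stack of every level.\<close>

fun is_lstack :: "nat \<Rightarrow> 'b lstack \<Rightarrow> bool" where
  "is_lstack l [] \<longleftrightarrow> True"
| "is_lstack l (\<Gamma> # \<Delta>) \<longleftrightarrow> is_lctx l \<Gamma> \<and> is_lstack (Suc l) \<Delta>"

inductive ltyping :: "nat \<Rightarrow> 'b lstack \<Rightarrow> trm \<Rightarrow> 'b lty \<Rightarrow> bool" where
  LVar: "is_lstack l (\<Gamma> # \<Delta>) \<Longrightarrow> (x, A) \<in> set \<Gamma> \<Longrightarrow> ltyping l (\<Gamma> # \<Delta>) (Var x) A"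
| LAbs: "ltyping l (((x, A) # \<Gamma>) # \<Delta>) M B \<Longrightarrow> ltyping l (\<Gamma> # \<Delta>) (Abs x M) (LFun A B)"
| LApp: "ltyping l \<Delta> M (LFun A B) \<Longrightarrow> ltyping l \<Delta> N A \<Longrightarrow> ltyping l \<Delta> (App M N) B"
| LQuo: "ltyping l ([] # \<Delta>) M A \<Longrightarrow> ltyping (Suc l) \<Delta> (Quo M) (LBox A)"
| LUnq: "ltyping (Suc l) \<Delta> M (LBox A) \<Longrightarrow> is_lctx l \<Gamma> \<Longrightarrow> ltyping l (\<Gamma> # \<Delta>) (Unq M) A"

definition lderivable :: "nat \<Rightarrow> 'b lstack \<Rightarrow> 'b lty \<Rightarrow> bool" where
  "lderivable l \<Delta> A \<longleftrightarrow> (\<exists>M. ltyping l \<Delta> M A)"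

inductive_cases is_lty_FunE: "is_lty l (LFun A B)"
inductive_cases is_lty_BoxE: "is_lty (Suc l) (LBox A)"

lemma ltyping_wf: "ltyping l \<Delta> M A \<Longrightarrow> is_lstack l \<Delta> \<and> is_lty l A"
  by (induction rule: ltyping.induct)
     (auto simp: is_lctx_def intro: is_lty.intros elim: is_lty_FunE is_lty_BoxE)


section \<open>The forgetful function\<close>

fun erase_ty :: "'b lty \<Rightarrow> 'b ty" where
  "erase_ty (LBase b l) = Base b"
| "erase_ty (LFun A B) = Fun (erase_ty A) (erase_ty B)"
| "erase_ty (LBox A) = Box (erase_ty A)"

definition erase_ctx :: "'b lctx \<Rightarrow> 'b ctx" where
  "erase_ctx \<Gamma> = map (\<lambda>(x, A). (x, erase_ty A)) \<Gamma>"

definition erase_stack :: "'b lstack \<Rightarrow> 'b stack" where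
  "erase_stack \<Delta> = map erase_ctx \<Delta>"

end

theory Submission
  imports Defs HOL.Filter
begin

text \<open>
  Quotation lowers and unquotation raises the current level by one, so along a fixed finite
  unleveled derivation the level varies by a bounded amount. Starting from a sufficiently high
  level, every type that occurs in the derivation has enough room for its boxes, and the
  derivation can be annotated with levels as it stands.
\<close>

lemma is_ctx_erase_ctx: "is_lctx l \<Gamma> \<Longrightarrow> is_ctx (erase_ctx \<Gamma>)"
  by (simp add: is_lctx_def is_ctx_def erase_ctx_def case_prod_unfold comp_def)

lemma is_stack_erase_stack: "is_lstack l \<Delta> \<Longrightarrow> is_stack (erase_stack \<Delta>)"
  by (induction l \<Delta> rule: is_lstack.induct)
     (auto simp: is_stack_def erase_stack_def is_ctx_erase_ctx)

lemma typing_erase: "ltyping l \<Delta> M A \<Longrightarrow> typing (erase_stack \<Delta>) M (erase_ty A)"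
proof (induction rule: ltyping.induct)
  case (LVar l \<Gamma> \<Delta> x A)
  have "is_stack (erase_ctx \<Gamma> # erase_stack \<Delta>)"
    using is_stack_erase_stack[OF LVar(1)] by (simp add: erase_stack_def)
  moreover have "(x, erase_ty A) \<in> set (erase_ctx \<Gamma>)"
    using LVar(2) by (force simp: erase_ctx_def)
  ultimately show ?case by (simp add: erase_stack_def typing.Var)
qed (auto simp: erase_stack_def erase_ctx_def is_ctx_erase_ctx[unfolded erase_ctx_def]
       intro: typing.intros)

text \<open>
  At level \<open>0\<close> a box has no leveled counterpart; there truncated subtraction yields an
  ill-leveled expression, which still erases correctly.
\<close>

fun lift_ty :: "nat \<Rightarrow> 'b ty \<Rightarrow> 'b lty" where
  "lift_ty l (Base b) = LBase b l"
| "lift_ty l (Fun A B) = LFun (lift_ty l A) (lift_ty l B)"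
| "lift_ty l (Box A) = LBox (lift_ty (l - 1) A)"

definition lift_ctx :: "nat \<Rightarrow> 'b ctx \<Rightarrow> 'b lctx" where
  "lift_ctx l \<Gamma> = map (\<lambda>(x, A). (x, lift_ty l A)) \<Gamma>"

fun lift_stack :: "nat \<Rightarrow> 'b stack \<Rightarrow> 'b lstack" where
  "lift_stack l [] = []"
| "lift_stack l (\<Gamma> # \<Delta>) = lift_ctx l \<Gamma> # lift_stack (Suc l) \<Delta>"

lemma erase_lift_ty [simp]: "erase_ty (lift_ty l A) = A"
  by (induction l A rule: lift_ty.induct) auto

lemma erase_lift_ctx [simp]: "erase_ctx (lift_ctx l \<Gamma>) = \<Gamma>"
  by (simp add: erase_ctx_def lift_ctx_def case_prod_unfold comp_def)

lemma erase_lift_stack [simp]: "erase_stack (lift_stack l \<Delta>) = \<Delta>"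
  by (induction l \<Delta> rule: lift_stack.induct) (auto simp: erase_stack_def)

text \<open>Only "all sufficiently large levels" is claimed, with no explicit bound: such claims
  survive finite conjunction and a shift by one, which is all that the inductions need.\<close>

lemma eventually_is_lty: "eventually (\<lambda>l. is_lty l (lift_ty l A)) sequentially"
proof (induction A)
  case (Base b)
  show ?case by (simp add: is_lty.intros)
next
  case (Fun A B)
  then show ?case by eventually_elim (simp add: is_lty.intros)
next
  case (Box A)
  \<comment> \<open>At a successor level the subtraction in \<open>lift_ty\<close> is exact; level
    0, where it is not, does not affect an eventual claim.\<close>
  then have "eventually (\<lambda>l. is_lty (Suc l) (lift_ty (Suc l) (Box A))) sequentially"
    by eventually_elim (simp add: is_lty.intros)
  then show ?case by (rule eventually_sequentially_Suc[THEN iffD1])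
qed

lemma eventually_is_lctx:
  assumes "is_ctx \<Gamma>"
  shows "eventually (\<lambda>l. is_lctx l (lift_ctx l \<Gamma>)) sequentially"
proof -
  \<comment> \<open>Each declaration has its own threshold; since \<open>set \<Gamma>\<close> is
    finite, one threshold serves them all.\<close>
  have "eventually (\<lambda>l. \<forall>p \<in> set \<Gamma>. is_lty l (lift_ty l (snd p))) sequentially"
    by (simp add: eventually_ball_finite eventually_is_lty)
  then show ?thesis
    by eventually_elim
       (use assms in \<open>auto simp: is_lctx_def is_ctx_def lift_ctx_def case_prod_unfold comp_def\<close>)
qed

lemma eventually_is_lstack:
  "is_stack \<Delta> \<Longrightarrow> eventually (\<lambda>l. is_lstack l (lift_stack l \<Delta>)) sequentially"
proof (induction \<Delta>)
  case (Cons \<Gamma> \<Delta>)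
  \<comment> \<open>The outer contexts sit one level above the rightmost one, so the induction
    hypothesis is needed at \<open>Suc l\<close>.\<close>
  then have "eventually (\<lambda>l. is_lstack (Suc l) (lift_stack (Suc l) \<Delta>)) sequentially"
    by (simp add: is_stack_def eventually_sequentially_Suc[where P = "\<lambda>l. is_lstack l (lift_stack l \<Delta>)"])
  moreover have "eventually (\<lambda>l. is_lctx l (lift_ctx l \<Gamma>)) sequentially"
    using Cons.prems by (simp add: is_stack_def eventually_is_lctx)
  ultimately show ?case by eventually_elim simp
qed simp

lemma eventually_ltyping:
  "typing \<Delta> M A \<Longrightarrow> eventually (\<lambda>l. ltyping l (lift_stack l \<Delta>) M (lift_ty l A)) sequentially"
proof (induction rule: typing.induct)
  case (Var \<Gamma> \<Delta> x A)
  have "(x, lift_ty l A) \<in> set (lift_ctx l \<Gamma>)" for l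
    using Var(2) by (force simp: lift_ctx_def)
  with eventually_is_lstack[OF Var(1)] show ?case
    by (auto elim!: eventually_mono intro: ltyping.LVar)
next
  case (Abs x A \<Gamma> \<Delta> M B)
  from Abs.IH show ?case
    by eventually_elim (simp add: lift_ctx_def ltyping.LAbs)
next
  case (App \<Delta> M A B N)
  \<comment> \<open>At a common level \<open>l\<close> both premises see the same argument type
    \<open>lift_ty l A\<close>, because lifting is a function of level and type.\<close>
  from App.IH show ?case
    by eventually_elim (auto intro: ltyping.LApp)
next
  case (Quo \<Delta> M A)
  \<comment> \<open>The premise at level \<open>l\<close> yields the conclusion at
    \<open>Suc l\<close>; afterwards the shift is undone.\<close>
  from Quo.IH
  have "eventually (\<lambda>l. ltyping (Suc l) (lift_stack (Suc l) \<Delta>) (Quo M) (lift_ty (Suc l) (Box A)))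
    sequentially"
    by eventually_elim (simp add: lift_ctx_def ltyping.LQuo)
  then show ?case by (rule eventually_sequentially_Suc[THEN iffD1])
next
  case (Unq \<Delta> M A \<Gamma>)
  \<comment> \<open>Here the shift goes the other way: the premise is taken at \<open>Suc l\<close>,
    where the lifted box is \<open>LBox (lift_ty l A)\<close>.\<close>
  from Unq.IH
  have "eventually (\<lambda>l. ltyping (Suc l) (lift_stack (Suc l) \<Delta>) M (lift_ty (Suc l) (Box A)))
    sequentially"
    by (rule eventually_sequentially_Suc[THEN iffD2])
  with eventually_is_lctx[OF Unq.hyps(2)] show ?case
    by eventually_elim (simp add: ltyping.LUnq)
qed

theorem theorem2p2:
  fixes \<Delta> :: "'b stack" and A :: "'b ty"
  assumes "is_stack \<Delta>"
  shows "derivable \<Delta> A \<longleftrightarrow>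
    (\<exists>(l :: nat) (\<Delta>' :: 'b lstack) (A' :: 'b lty).
      is_lstack l \<Delta>' \<and> is_lty l A' \<and> lderivable l \<Delta>' A' \<and>
      erase_stack \<Delta>' = \<Delta> \<and> erase_ty A' = A)"
proof
  assume "derivable \<Delta> A"
  then obtain M where "typing \<Delta> M A"
    by (auto simp: derivable_def)
  \<comment> \<open>The filter \<open>sequentially\<close> is proper, so a claim that holds
    eventually holds at some level.\<close>
  from eventually_happens[OF eventually_ltyping[OF this]]
  obtain l where l: "ltyping l (lift_stack l \<Delta>) M (lift_ty l A)"
    by auto
  from l ltyping_wf[OF l] show "\<exists>l \<Delta>' A'. is_lstack l \<Delta>' \<and> is_lty l A' \<and> lderivable l \<Delta>' A' \<and>
      erase_stack \<Delta>' = \<Delta> \<and> erase_ty A' = A"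
    by (intro exI[of _ l] exI[of _ "lift_stack l \<Delta>"] exI[of _ "lift_ty l A"])
       (auto simp: lderivable_def)
next
  assume "\<exists>l \<Delta>' A'. is_lstack l \<Delta>' \<and> is_lty l A' \<and> lderivable l \<Delta>' A' \<and>
      erase_stack \<Delta>' = \<Delta> \<and> erase_ty A' = A"
  then show "derivable \<Delta> A"
    \<comment> \<open>Raw terms carry no levels, so the leveled derivation's own term is the
      witness.\<close>
    by (auto simp: lderivable_def derivable_def dest: typing_erase)
qed

end
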